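(* Let $G$ and $G'$ be graphs and let $\mathbf{T}'\in\mathit{Ter}(\mathcal{B}(t))$ be a $t$-concrete tree decomposition with $\mathcal{G}(\mathbf{T}')=G'$. Then $G$ is a subgraph of $G'$ if and only if there exists $\mathbf{T}\in\mathit{Ter}(\mathcal{B}(t))$ such that $\mathbf{T}$ is a sub-decomposition of $\mathbf{T}'$ and $\mathcal{G}(\mathbf{T})=G$.
   Context: Graphs: a graph is a triple $G=(V_G,E_G,\mathrm{Inc}_G)$ with finite vertex set, finite edge set and incidence relation $\mathrm{Inc}_G\subseteq E_G\times V_G$; each edge has $0$ or $2$ endpoints (multiple edges allowed, no loops). $H$ is a subgraph of $G$ if $V_H\subseteq V_G$, $E_H\subseteq E_G$ and $\mathrm{Inc}_H=\mathrm{Inc}_G\cap(E_H\times V_H)$. Terms: for a finite alphabet $\Sigma$, $\mathit{Ter}(\Sigma)$ is the smallest set with $a$, $a(t_1)$, $a(t_1,t_2)\in\mathit{Ter}(\Sigma)$ for $a\in\Sigma$, $t_i\in\mathit{Ter}(\Sigma)$. Positions: $\mathit{Pos}(a(t_1,\dots,t_r))=\{\lambda\}\cup\bigcup_{j\le r}\{jp\mid p\in\mathit{Pos}(t_j)\}$; $pj$ is a child of $p$; $t[p]$ is the symbol at $p$. A set of positions is connected if it induces a connected subtree of the tree on $\mathit{Pos}(t)$ with arcs $\{p,pj\}$. A $t$-concrete bag is a pair $(B,b)$ with $B\subseteq\{1,\dots,t\}$, $b\subseteq B$, $b=\emptyset$ or $|b|=2$; $\mathcal{B}(t)$ is the set of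 them. A $t$-concrete tree decomposition is a term $\mathbf{T}\in\mathit{Ter}(\mathcal{B}(t))$, with $\mathbf{T}[p]=(\mathbf{T}[p].B,\mathbf{T}[p].b)$. For $s\in[t]$, a nonempty $P\subseteq\mathit{Pos}(\mathbf{T})$ is $s$-maximal if it is connected, $s\in\mathbf{T}[p].B$ for all $p\in P$, and every connected $P'$ with $s\in\mathbf{T}[p].B$ for all $p\in P'$ satisfies $P\cap P'=\emptyset$ or $P'\subseteq P$; $P(p,s)$ is the unique $s$-maximal set containing $p$ (when $s\in\mathbf{T}[p].B$). The graph $\mathcal{G}(\mathbf{T})$ has vertex set $\{v_{s,P}\mid s\in[t], P\text{ $s$-maximal}\}$, edge set $\{e_p\mid p\in\mathit{Pos}(\mathbf{T}), \mathbf{T}[p].b\ne\emptyset\}$, and incidence relation $\{(e_p,v_{s,P(p,s)})\mid e_p \text{ an edge}, s\in\mathbf{T}[p].b\}$. A $t$-concrete bag $(B,b)$ is a sub-bag of $(B',b')$ if $B\subseteq B'$ and $b\subseteq b'$. $\mathbf{T}$ is a sub-decomposition of $\mathbf{T}'$ if (S1) $\mathit{Pos}(\mathbf{T})=\mathit{Pos}(\mathbf{T}')$; (S2) for each $p$, $\mathbf{T}[p]$ is a sub-bag of $\mathbf{T}'[p]$; (S3) for all positions $p,pj$ and each $s\in[t]$, if $s\in\mathbf{T}'[p].B$ and $s\in\mathbf{T}'[pj].B$ then $s\notin\mathbf{T}[p].B$ iff $s\notin\mathbf{T}[pj].B$.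
   Formalization: The left side of the equivalence also requires that every edge of G has an endpoint; without this the claim fails, since a subgraph may keep an edge while dropping both its endpoints, whereas every edge of G(T) has two endpoints. *)

theory Defs
  imports Main
begin

record ('v, 'e) inc_graph =
  verts :: "'v set"
  edges :: "'e set"
  inc :: "('e \<times> 'v) set"

definition endpts :: "('v, 'e) inc_graph \<Rightarrow> 'e \<Rightarrow> 'v set" where
  "endpts G e = {v. (e, v) \<in> inc G}"

definition is_graph :: "('v, 'e) inc_graph \<Rightarrow> bool" where
  "is_graph G \<longleftrightarrow>
     finite (verts G) \<and> finite (edges G) \<and> inc G \<subseteq> edges G \<times> verts G \<and>
     (\<forall>e\<in>edges G. card (endpts G e) = 0 \<or> card (endpts G e) = 2)"

definition subgraph :: "('v, 'e) inc_graph \<Rightarrow> ('v, 'e) inc_graph \<Rightarrow> bool" where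
  "subgraph H G \<longleftrightarrow>
     verts H \<subseteq> verts G \<and> edges H \<subseteq> edges G \<and> inc H = inc G \<inter> (edges H \<times> verts H)"

datatype 'a trm = Sym0 'a | Sym1 'a "'a trm" | Sym2 'a "'a trm" "'a trm"

inductive_set Ter :: "'a set \<Rightarrow> 'a trm set" for \<Sigma> :: "'a set" where
  "a \<in> \<Sigma> \<Longrightarrow> Sym0 a \<in> Ter \<Sigma>"
| "a \<in> \<Sigma> \<Longrightarrow> t1 \<in> Ter \<Sigma> \<Longrightarrow> Sym1 a t1 \<in> Ter \<Sigma>"
| "a \<in> \<Sigma> \<Longrightarrow> t1 \<in> Ter \<Sigma> \<Longrightarrow> t2 \<in> Ter \<Sigma> \<Longrightarrow> Sym2 a t1 t2 \<in> Ter \<Sigma>"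

type_synonym pos = "nat list"

fun Pos :: "'a trm \<Rightarrow> pos set" where
  "Pos (Sym0 a) = {[]}"
| "Pos (Sym1 a t1) = {[]} \<union> {1 # p | p. p \<in> Pos t1}"
| "Pos (Sym2 a t1 t2) = {[]} \<union> {1 # p | p. p \<in> Pos t1} \<union> {2 # p | p. p \<in> Pos t2}"

text \<open>The symbol of a term at a position; only meaningful for positions of the term.\<close>

fun sym_at :: "'a trm \<Rightarrow> pos \<Rightarrow> 'a" where
  "sym_at (Sym0 a) [] = a"
| "sym_at (Sym1 a t1) [] = a"
| "sym_at (Sym2 a t1 t2) [] = a"
| "sym_at (Sym0 a) (j # p) = undefined"
| "sym_at (Sym1 a t1) (j # p) = (if j = 1 then sym_at t1 p else undefined)"
| "sym_at (Sym2 a t1 t2) (j # p) =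
     (if j = 1 then sym_at t1 p else if j = 2 then sym_at t2 p else undefined)"

definition arcs :: "(pos \<times> pos) set" where
  "arcs = {(p, q). \<exists>j. q = p @ [j] \<or> p = q @ [j]}"

definition connected_pos :: "'a trm \<Rightarrow> pos set \<Rightarrow> bool" where
  "connected_pos T P \<longleftrightarrow>
     P \<subseteq> Pos T \<and> (\<forall>p\<in>P. \<forall>q\<in>P. (p, q) \<in> (arcs \<inter> P \<times> P)\<^sup>*)"

type_synonym bag = "nat set \<times> nat set"

definition bags :: "nat \<Rightarrow> bag set" where
  "bags t = {(B, b). B \<subseteq> {1..t} \<and> b \<subseteq> B \<and> (b = {} \<or> card b = 2)}"

definition bag_B :: "bag trm \<Rightarrow> pos \<Rightarrow> nat set" where
  "bag_B T p = fst (sym_at T p)"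

definition bag_b :: "bag trm \<Rightarrow> pos \<Rightarrow> nat set" where
  "bag_b T p = snd (sym_at T p)"

definition s_maximal :: "bag trm \<Rightarrow> nat \<Rightarrow> pos set \<Rightarrow> bool" where
  "s_maximal T s P \<longleftrightarrow>
     P \<noteq> {} \<and> connected_pos T P \<and> (\<forall>p\<in>P. s \<in> bag_B T p) \<and>
     (\<forall>P'. connected_pos T P' \<and> (\<forall>p\<in>P'. s \<in> bag_B T p) \<longrightarrow> P \<inter> P' = {} \<or> P' \<subseteq> P)"

definition max_set :: "bag trm \<Rightarrow> pos \<Rightarrow> nat \<Rightarrow> pos set" where
  "max_set T p s = (THE P. s_maximal T s P \<and> p \<in> P)"

datatype vertex = Vtx nat "pos set"
datatype edge = Edg pos

definition graph_of :: "nat \<Rightarrow> bag trm \<Rightarrow> (vertex, edge) inc_graph" where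
  "graph_of t T =
     \<lparr>verts = {Vtx s P | s P. s \<in> {1..t} \<and> s_maximal T s P},
      edges = {Edg p | p. p \<in> Pos T \<and> bag_b T p \<noteq> {}},
      inc = {(Edg p, Vtx s (max_set T p s)) | p s.
               p \<in> Pos T \<and> bag_b T p \<noteq> {} \<and> s \<in> bag_b T p}\<rparr>"

definition sub_bag :: "bag \<Rightarrow> bag \<Rightarrow> bool" where
  "sub_bag x y \<longleftrightarrow> fst x \<subseteq> fst y \<and> snd x \<subseteq> snd y"

definition sub_decomposition :: "nat \<Rightarrow> bag trm \<Rightarrow> bag trm \<Rightarrow> bool" where
  "sub_decomposition t T T' \<longleftrightarrow>
     Pos T = Pos T' \<and>
     (\<forall>p\<in>Pos T. sub_bag (sym_at T p) (sym_at T' p)) \<and>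
     (\<forall>p j s. p \<in> Pos T' \<and> p @ [j] \<in> Pos T' \<and> s \<in> {1..t} \<and>
        s \<in> bag_B T' p \<and> s \<in> bag_B T' (p @ [j]) \<longrightarrow>
        (s \<notin> bag_B T p \<longleftrightarrow> s \<notin> bag_B T (p @ [j])))"

end

theory Submission
  imports Defs
begin

text \<open>
  The \<open>s\<close>-maximal sets are the connected components of the set of positions whose bag contains \<open>s\<close>.
  Condition (S3) says that for each \<open>s\<close> this set for \<open>T\<close> is a union of components of the one
  for \<open>T'\<close>; hence passing to a sub-decomposition amounts to selecting vertices of the graph, and
  (as nonempty \<open>b\<close>-parts have exactly two elements) edges whose endpoints are all selected.
\<close>

section \<open>Terms and their labels at positions\<close>

lemma Ter_iff_sym_at: "T \<in> Ter \<Sigma> \<longleftrightarrow> (\<forall>p\<in>Pos T. sym_at T p \<in> \<Sigma>)"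
proof
  assume "T \<in> Ter \<Sigma>"
  then show "\<forall>p\<in>Pos T. sym_at T p \<in> \<Sigma>"
    by (induction rule: Ter.induct) auto
next
  assume "\<forall>p\<in>Pos T. sym_at T p \<in> \<Sigma>"
  then show "T \<in> Ter \<Sigma>"
  proof (induction T)
    case (Sym0 a)
    then show ?case by (auto intro: Ter.intros)
  next
    case (Sym1 a T1)
    have "a \<in> \<Sigma>" using Sym1.prems by (auto dest: bspec[where x = "[]"])
    moreover have "T1 \<in> Ter \<Sigma>"
      using Sym1.prems by (intro Sym1.IH ballI) (auto dest!: bspec[where x = "1 # _"])
    ultimately show ?case by (rule Ter.intros)
  next
    case (Sym2 a T1 T2)
    have "a \<in> \<Sigma>" using Sym2.prems by (auto dest: bspec[where x = "[]"])
    moreover have "T1 \<in> Ter \<Sigma>"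
      using Sym2.prems by (intro Sym2.IH(1) ballI) (auto dest!: bspec[where x = "1 # _"])
    moreover have "T2 \<in> Ter \<Sigma>"
      using Sym2.prems by (intro Sym2.IH(2) ballI) (auto dest!: bspec[where x = "2 # _"])
    ultimately show ?case by (rule Ter.intros)
  qed
qed

text \<open>The old labels are discarded and only the shape of the term survives, so (S1) is
  automatic for a decomposition obtained by relabelling \<open>T'\<close>.\<close>

fun relabel :: "(pos \<Rightarrow> 'b) \<Rightarrow> 'a trm \<Rightarrow> 'b trm" where
  "relabel f (Sym0 a) = Sym0 (f [])"
| "relabel f (Sym1 a t1) = Sym1 (f []) (relabel (\<lambda>p. f (1 # p)) t1)"
| "relabel f (Sym2 a t1 t2) =
     Sym2 (f []) (relabel (\<lambda>p. f (1 # p)) t1) (relabel (\<lambda>p. f (2 # p)) t2)"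

lemma Pos_relabel [simp]: "Pos (relabel f T) = Pos T"
  by (induction T arbitrary: f) auto

lemma sym_at_relabel: "p \<in> Pos T \<Longrightarrow> sym_at (relabel f T) p = f p"
  by (induction T arbitrary: f p) auto

section \<open>Connected components of sets of positions\<close>

definition component :: "pos set \<Rightarrow> pos \<Rightarrow> pos set" where
  "component A p = {q. (p, q) \<in> (arcs \<inter> A \<times> A)\<^sup>*}"

definition bag_support :: "bag trm \<Rightarrow> nat \<Rightarrow> pos set" where
  "bag_support T s = {p \<in> Pos T. s \<in> bag_B T p}"

lemma self_in_component: "p \<in> component A p"
  by (simp add: component_def)

lemma sym_arcs_restrict: "sym (arcs \<inter> A \<times> A)"
  by (auto simp: sym_def arcs_def)

lemma component_eq:
  assumes "q \<in> component A p"
  shows "component A q = component A p"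
proof -
  have "(p, q) \<in> (arcs \<inter> A \<times> A)\<^sup>*"
    using assms by (simp add: component_def)
  moreover from this have "(q, p) \<in> (arcs \<inter> A \<times> A)\<^sup>*"
    using sym_rtrancl[OF sym_arcs_restrict] by (meson symD)
  ultimately show ?thesis
    unfolding component_def by (auto intro: rtrancl_trans)
qed

text \<open>Membership of \<open>p\<close> in \<open>A\<close> matters: the closure is reflexive, so
  a \<open>p\<close> outside \<open>A\<close> still has the component \<open>{p}\<close>.\<close>

lemma component_subset: "p \<in> A \<Longrightarrow> component A p \<subseteq> A"
  unfolding component_def by (auto elim: rtranclE)

text \<open>A path in \<open>A'\<close> that starts in \<open>A\<close> can never leave
  \<open>A\<close>. This serves twice: for a component inside its ambient set, and for the support
  of a label in \<open>T\<close> inside its support in \<open>T'\<close>.\<close>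

lemma component_of_closed_subset:
  assumes "A \<subseteq> A'" and closed: "\<And>x y. x \<in> A \<Longrightarrow> y \<in> A' \<Longrightarrow> (x, y) \<in> arcs \<Longrightarrow> y \<in> A"
    and "p \<in> A"
  shows "component A p = component A' p"
proof
  show "component A p \<subseteq> component A' p"
    unfolding component_def using assms(1)
    by (auto elim!: rtrancl_mono[THEN subsetD, rotated])
  have "(p, q) \<in> (arcs \<inter> A \<times> A)\<^sup>* \<and> q \<in> A" if "(p, q) \<in> (arcs \<inter> A' \<times> A')\<^sup>*" for q
    using that
  proof (induction rule: rtrancl_induct)
    case base
    then show ?case using \<open>p \<in> A\<close> by simp
  next
    case (step y z)
    then have "z \<in> A" using closed by blast
    with step show ?case by (auto intro: rtrancl_into_rtrancl)
  qed
  then show "component A' p \<subseteq> component A p"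
    unfolding component_def by blast
qed

text \<open>The component is closed under arcs within \<open>A\<close>, so the preceding lemma turns
  paths in \<open>A\<close> between its points into paths inside the component.\<close>

lemma component_connected:
  assumes "p \<in> A" "q \<in> component A p" "r \<in> component A p"
  shows "(q, r) \<in> (arcs \<inter> component A p \<times> component A p)\<^sup>*"
proof -
  let ?C = "component A p"
  have "component ?C q = component A q"
  proof (rule component_of_closed_subset)
    show "?C \<subseteq> A" using component_subset[OF assms(1)] .
    fix x y assume "x \<in> ?C" "y \<in> A" "(x, y) \<in> arcs"
    moreover from this have "x \<in> A" using component_subset[OF assms(1)] by blast
    ultimately show "y \<in> ?C"
      unfolding component_def by (auto intro: rtrancl_into_rtrancl)
  qed (fact assms(2))
  moreover have "r \<in> component A q"
    using assms(3) component_eq[OF assms(2)] by simp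
  ultimately show ?thesis
    unfolding component_def by blast
qed

lemma connected_subset_component:
  assumes "connected_pos T P" "P \<subseteq> A" "p \<in> P"
  shows "P \<subseteq> component A p"
proof
  fix q assume "q \<in> P"
  with assms have "(p, q) \<in> (arcs \<inter> P \<times> P)\<^sup>*"
    by (simp add: connected_pos_def)
  moreover have "(arcs \<inter> P \<times> P)\<^sup>* \<subseteq> (arcs \<inter> A \<times> A)\<^sup>*"
    using assms(2) by (intro rtrancl_mono) blast
  ultimately show "q \<in> component A p"
    by (auto simp: component_def)
qed

section \<open>Maximal sets as components of supports\<close>

lemma s_maximal_component:
  assumes "p \<in> bag_support T s"
  shows "s_maximal T s (component (bag_support T s) p)"
proof -
  let ?A = "bag_support T s" and ?C = "component (bag_support T s) p"
  have sub: "?C \<subseteq> ?A" using component_subset[OF assms] .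
  \<comment> \<open>A connected set of positions carrying \<open>s\<close> that meets the component
    at \<open>q\<close> lies in the component of \<open>q\<close>, which is the same one.\<close>
  have "P' \<subseteq> ?C" if "connected_pos T P'" "\<forall>p\<in>P'. s \<in> bag_B T p" "?C \<inter> P' \<noteq> {}" for P'
  proof -
    obtain q where q: "q \<in> ?C" "q \<in> P'" using \<open>?C \<inter> P' \<noteq> {}\<close> by blast
    have "P' \<subseteq> ?A"
      using that by (auto simp: bag_support_def connected_pos_def)
    then have "P' \<subseteq> component ?A q"
      using connected_subset_component that(1) q(2) by blast
    then show ?thesis using component_eq[OF q(1)] by simp
  qed
  moreover have "connected_pos T ?C"
    unfolding connected_pos_def using sub component_connected[OF assms]
    by (auto simp: bag_support_def)
  moreover have "?C \<noteq> {}" using self_in_component by blast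
  ultimately show ?thesis
    unfolding s_maximal_def using sub by (auto simp: bag_support_def)
qed

text \<open>Connectedness of \<open>P\<close> puts it inside the component; maximality of
  \<open>P\<close>, tested against the component, gives the other inclusion.\<close>

lemma s_maximal_unique:
  assumes "s_maximal T s P" "p \<in> P"
  shows "P = component (bag_support T s) p"
proof -
  have P: "connected_pos T P" "P \<subseteq> bag_support T s"
    using assms(1) by (auto simp: s_maximal_def bag_support_def connected_pos_def)
  with assms(2) have p: "p \<in> bag_support T s" by blast
  have "P \<subseteq> component (bag_support T s) p"
    using connected_subset_component P assms(2) by blast
  moreover have "component (bag_support T s) p \<subseteq> P"
    using assms s_maximal_component[OF p] self_in_component[of p "bag_support T s"]
    unfolding s_maximal_def by blast
  ultimately show ?thesis by simp
qed

lemma s_maximal_iff: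
  "s_maximal T s P \<longleftrightarrow> (\<exists>p\<in>bag_support T s. P = component (bag_support T s) p)"
proof
  assume P: "s_maximal T s P"
  then obtain p where p: "p \<in> P" by (auto simp: s_maximal_def)
  with P have "p \<in> bag_support T s"
    by (auto simp: s_maximal_def bag_support_def connected_pos_def)
  with s_maximal_unique[OF P p] show "\<exists>p\<in>bag_support T s. P = component (bag_support T s) p"
    by blast
qed (auto intro: s_maximal_component)

text \<open>Existence and uniqueness from the lemmas above make the definite description in
  \<open>max_set\<close> well defined on the support.\<close>

lemma max_set_eq_component:
  assumes "p \<in> bag_support T s"
  shows "max_set T p s = component (bag_support T s) p"
  unfolding max_set_def
  using s_maximal_component[OF assms] self_in_component s_maximal_unique
  by (intro the_equality) blast+

section \<open>The graph of a decomposition in terms of components\<close>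

lemma bag_Ter_bags:
  assumes "T \<in> Ter (bags t)" "p \<in> Pos T"
  shows "bag_B T p \<subseteq> {1..t}" "bag_b T p \<subseteq> bag_B T p" "bag_b T p = {} \<or> card (bag_b T p) = 2"
proof -
  have "sym_at T p \<in> bags t" using assms Ter_iff_sym_at by blast
  then show "bag_B T p \<subseteq> {1..t}" "bag_b T p \<subseteq> bag_B T p" "bag_b T p = {} \<or> card (bag_b T p) = 2"
    by (auto simp: bags_def bag_B_def bag_b_def)
qed

lemma verts_graph_of:
  "verts (graph_of t T) =
     {Vtx s (component (bag_support T s) p) | s p. s \<in> {1..t} \<and> p \<in> bag_support T s}"
  by (auto simp: graph_of_def s_maximal_iff)

lemma edges_graph_of: "edges (graph_of t T) = {Edg p | p. p \<in> Pos T \<and> bag_b T p \<noteq> {}}"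
  by (simp add: graph_of_def)

text \<open>The inclusion of the b-part in the B-part puts \<open>p\<close> in the support of each
  of its edge labels, where \<open>max_set\<close> is a genuine component.\<close>

lemma inc_graph_of:
  assumes "T \<in> Ter (bags t)"
  shows "inc (graph_of t T) =
    {(Edg p, Vtx s (component (bag_support T s) p)) | p s. p \<in> Pos T \<and> s \<in> bag_b T p}"
proof -
  have "max_set T p s = component (bag_support T s) p" if "p \<in> Pos T" "s \<in> bag_b T p" for p s
    using bag_Ter_bags(2)[OF assms that(1)] that
    by (intro max_set_eq_component) (auto simp: bag_support_def)
  then show ?thesis
    unfolding graph_of_def inc_graph.simps by blast
qed

lemma endpts_graph_of:
  assumes "T \<in> Ter (bags t)" "p \<in> Pos T"
  shows "endpts (graph_of t T) (Edg p) =
    (\<lambda>s. Vtx s (component (bag_support T s) p)) ` bag_b T p"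
  using assms(2) by (auto simp: endpts_def inc_graph_of[OF assms(1)])

section \<open>From sub-decompositions to subgraphs\<close>

lemma sub_decomposition_component:
  assumes sub: "sub_decomposition t T T'" and "s \<in> {1..t}" and "p \<in> bag_support T s"
  shows "component (bag_support T s) p = component (bag_support T' s) p"
proof (rule component_of_closed_subset)
  show "bag_support T s \<subseteq> bag_support T' s"
    using sub by (auto simp: sub_decomposition_def sub_bag_def bag_support_def bag_B_def)
  \<comment> \<open>This closure is (S3), read along an arc in either direction.\<close>
  then show "y \<in> bag_support T s"
    if "x \<in> bag_support T s" "y \<in> bag_support T' s" "(x, y) \<in> arcs" for x y
    using that sub \<open>s \<in> {1..t}\<close>
    unfolding sub_decomposition_def bag_support_def arcs_def by blast
qed (fact assms(3))

text \<open>Both b-parts have exactly two elements, so the inclusion from (S2) is an equality: a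
  surviving edge keeps both of its labels.\<close>

lemma sub_decomposition_bag_b:
  assumes "sub_decomposition t T T'" "T \<in> Ter (bags t)" "T' \<in> Ter (bags t)"
    and "p \<in> Pos T" "bag_b T p \<noteq> {}"
  shows "bag_b T p = bag_b T' p"
proof (rule card_subset_eq)
  have sub: "bag_b T p \<subseteq> bag_b T' p" and p': "p \<in> Pos T'"
    using assms by (auto simp: sub_decomposition_def sub_bag_def bag_b_def)
  then show "bag_b T p \<subseteq> bag_b T' p" by simp
  have "card (bag_b T p) = 2" "card (bag_b T' p) = 2"
    using bag_Ter_bags(3)[OF assms(2,4)] bag_Ter_bags(3)[OF assms(3) p'] assms(5) sub by auto
  then show "card (bag_b T p) = card (bag_b T' p)" "finite (bag_b T' p)"
    by (auto intro: card_ge_0_finite)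
qed

text \<open>Vertices are named by a label and a component, edges by a position. As surviving
  components do not change, the inclusions hold literally, without renaming.\<close>

lemma subgraph_of_sub_decomposition:
  assumes sub: "sub_decomposition t T T'" and T: "T \<in> Ter (bags t)" and T': "T' \<in> Ter (bags t)"
  shows "subgraph (graph_of t T) (graph_of t T')"
proof -
  note comp = sub_decomposition_component[OF sub]
  note b = sub_decomposition_bag_b[OF sub T T']
  have pos: "Pos T = Pos T'" using sub by (simp add: sub_decomposition_def)
  have supp: "bag_support T s \<subseteq> bag_support T' s" for s
    using sub by (auto simp: sub_decomposition_def sub_bag_def bag_support_def bag_B_def)
  have b_supp: "s \<in> {1..t} \<and> p \<in> bag_support T s" if "p \<in> Pos T" "s \<in> bag_b T p" for p s
    using bag_Ter_bags(1,2)[OF T that(1)] that by (auto simp: bag_support_def)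
  have V: "verts (graph_of t T) \<subseteq> verts (graph_of t T')"
    unfolding verts_graph_of using comp supp by blast
  have E: "edges (graph_of t T) \<subseteq> edges (graph_of t T')"
    unfolding edges_graph_of using b pos by fastforce
  have "inc (graph_of t T) = inc (graph_of t T') \<inter> edges (graph_of t T) \<times> verts (graph_of t T)"
  proof (intro equalityI subsetI)
    fix x assume "x \<in> inc (graph_of t T)"
    then obtain p s where x: "x = (Edg p, Vtx s (component (bag_support T s) p))"
      and p: "p \<in> Pos T" "s \<in> bag_b T p"
      unfolding inc_graph_of[OF T] by blast
    note s = b_supp[OF p]
    have "x \<in> inc (graph_of t T')"
      unfolding inc_graph_of[OF T'] using x p b[OF p(1)] comp s pos by blast
    moreover have "x \<in> edges (graph_of t T) \<times> verts (graph_of t T)"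
      unfolding edges_graph_of verts_graph_of using x p s by blast
    ultimately show "x \<in> inc (graph_of t T') \<inter> edges (graph_of t T) \<times> verts (graph_of t T)" ..
  next
    fix x assume x: "x \<in> inc (graph_of t T') \<inter> edges (graph_of t T) \<times> verts (graph_of t T)"
    then obtain p s where p: "x = (Edg p, Vtx s (component (bag_support T' s) p))"
      "p \<in> Pos T'" "s \<in> bag_b T' p"
      unfolding inc_graph_of[OF T'] by blast
    \<comment> \<open>The edge at \<open>p\<close> survives in \<open>T\<close>, so its b-part is
      that of \<open>T'\<close> and contains \<open>s\<close>.\<close>
    have "bag_b T p \<noteq> {}" using x p(1) by (auto simp: edges_graph_of)
    then have s: "s \<in> bag_b T p" using b p pos by blast
    then show "x \<in> inc (graph_of t T)"
      unfolding inc_graph_of[OF T] using p pos comp b_supp[of p s] by force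
  qed
  with V E show ?thesis by (simp add: subgraph_def)
qed

section \<open>From subgraphs to sub-decompositions\<close>

definition restrict_bag :: "bag trm \<Rightarrow> (vertex, edge) inc_graph \<Rightarrow> pos \<Rightarrow> bag" where
  "restrict_bag T G p =
     ({s \<in> bag_B T p. Vtx s (component (bag_support T s) p) \<in> verts G},
      if Edg p \<in> edges G then bag_b T p else {})"

text \<open>The delicate point is that each new b-part lies in the new B-part, that is, that both
  endpoints of a kept edge are kept vertices. This is where \<open>nonempty\<close> enters.\<close>

lemma sub_decomposition_of_subgraph:
  assumes G: "is_graph G" and T': "T' \<in> Ter (bags t)" and sub: "subgraph G (graph_of t T')"
    and nonempty: "\<forall>e\<in>edges G. endpts G e \<noteq> {}"
  defines "T \<equiv> relabel (restrict_bag T' G) T'"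
  shows "T \<in> Ter (bags t)" "sub_decomposition t T T'" "graph_of t T = G"
proof -
  let ?v = "\<lambda>s p. Vtx s (component (bag_support T' s) p)"
  have pos: "Pos T = Pos T'" by (simp add: T_def)
  have sym: "sym_at T p = restrict_bag T' G p" if "p \<in> Pos T'" for p
    using that by (simp add: T_def sym_at_relabel)
  have B: "bag_B T p = {s \<in> bag_B T' p. ?v s p \<in> verts G}"
    and b: "bag_b T p = (if Edg p \<in> edges G then bag_b T' p else {})" if "p \<in> Pos T'" for p
    using sym[OF that] by (auto simp: bag_B_def bag_b_def restrict_bag_def)
  \<comment> \<open>In \<open>G\<close> the edge has 0 or 2 endpoints, hence 2 by
    \<open>nonempty\<close>. They are among its two endpoints in \<open>graph_of t T'\<close>, so
    none is lost.\<close>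
  have endpoints_kept: "?v s p \<in> verts G" if "Edg p \<in> edges G" "p \<in> Pos T'" "s \<in> bag_b T' p" for p s
  proof -
    let ?E' = "endpts (graph_of t T') (Edg p)"
    have E': "?E' = (\<lambda>s. ?v s p) ` bag_b T' p"
      by (rule endpts_graph_of[OF T' that(2)])
    have b2: "card (bag_b T' p) = 2"
      using bag_Ter_bags(3)[OF T' that(2)] that(3) by auto
    have fin: "finite ?E'"
      unfolding E' using b2 by (intro finite_imageI card_ge_0_finite) simp
    \<comment> \<open>Different labels give different vertices because \<open>Vtx\<close> records
      the label.\<close>
    have "card ?E' = 2"
      unfolding E' using b2 by (subst card_image) (auto simp: inj_on_def)
    moreover have le: "endpts G (Edg p) \<subseteq> ?E'"
      using sub by (auto simp: endpts_def subgraph_def)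
    moreover have "card (endpts G (Edg p)) = 2"
    proof -
      have "endpts G (Edg p) \<noteq> {}" using nonempty that(1) by blast
      \<comment> \<open>\<open>card\<close> is 0 on infinite sets too, so nonemptiness alone would
        not suffice; finiteness comes from \<open>?E'\<close>.\<close>
      with le fin have "card (endpts G (Edg p)) \<noteq> 0"
        using finite_subset by fastforce
      with G that(1) show ?thesis unfolding is_graph_def by metis
    qed
    ultimately have "endpts G (Edg p) = ?E'"
      using fin by (intro card_subset_eq) auto
    then have "(Edg p, ?v s p) \<in> inc G"
      using that(3) E' by (auto simp: endpts_def)
    then show ?thesis using G by (auto simp: is_graph_def)
  qed
  show Tin: "T \<in> Ter (bags t)"
    unfolding Ter_iff_sym_at
  proof
    fix p assume "p \<in> Pos T"
    then have p: "p \<in> Pos T'" by (simp add: pos)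
    have "bag_B T p \<subseteq> {1..t}" "bag_b T p \<subseteq> bag_B T p" "bag_b T p = {} \<or> card (bag_b T p) = 2"
      unfolding B[OF p] b[OF p] using bag_Ter_bags[OF T' p] endpoints_kept[OF _ p] by auto
    then show "sym_at T p \<in> bags t"
      by (auto simp: bags_def bag_B_def bag_b_def case_prod_beta)
  qed
  show dec: "sub_decomposition t T T'"
    unfolding sub_decomposition_def
  proof (intro conjI ballI allI impI, goal_cases)
    case 1
    show ?case by (rule pos)
  next
    case (2 p)
    then show ?case
      using B[of p] b[of p] by (auto simp: pos sub_bag_def bag_B_def bag_b_def split: if_splits)
  next
    case (3 p j s)
    \<comment> \<open>For (S3): adjacent positions carrying \<open>s\<close> in \<open>T'\<close>
      share a component and so name the same vertex; the test in \<open>restrict_bag\<close> keeps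
      or drops \<open>s\<close> at both.\<close>
    then have "p @ [j] \<in> component (bag_support T' s) p"
      by (auto simp: component_def bag_support_def arcs_def)
    from component_eq[OF this] 3 show ?case by (simp add: B)
  qed
  have "verts (graph_of t T) = verts G"
  proof (intro equalityI subsetI)
    fix x assume "x \<in> verts (graph_of t T)"
    then obtain s p where s: "x = Vtx s (component (bag_support T s) p)" "s \<in> {1..t}"
      "p \<in> bag_support T s"
      unfolding verts_graph_of by blast
    then show "x \<in> verts G"
      using sub_decomposition_component[OF dec s(2,3)] B by (auto simp: bag_support_def pos)
  next
    fix x assume x: "x \<in> verts G"
    then have "x \<in> verts (graph_of t T')" using sub by (auto simp: subgraph_def)
    then obtain s p where s: "x = ?v s p" "s \<in> {1..t}" "p \<in> bag_support T' s"
      unfolding verts_graph_of by blast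
    then have p: "p \<in> bag_support T s"
      using B x by (auto simp: bag_support_def pos)
    then show "x \<in> verts (graph_of t T)"
      unfolding verts_graph_of using s sub_decomposition_component[OF dec s(2) p] by force
  qed
  moreover have "edges (graph_of t T) = edges G"
    using sub b by (auto simp: edges_graph_of pos subgraph_def split: if_splits)
  \<comment> \<open>Both relations restrict the incidence of \<open>graph_of t T'\<close> to the
    same edges and vertices.\<close>
  moreover have "inc (graph_of t T) = inc G"
    using subgraph_of_sub_decomposition[OF dec Tin T'] sub calculation
    by (simp add: subgraph_def)
  ultimately show "graph_of t T = G" by simp
qed

text \<open>The condition on endpoints is there because \<open>subgraph\<close> lets an edge stay
  after both its endpoints are removed, whereas an edge of \<open>graph_of t T\<close> comes from a
  nonempty b-part and so always has endpoints.\<close>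

theorem theorem4p2:
  fixes G G' :: "(vertex, edge) inc_graph" and t :: nat and T' :: "bag trm"
  assumes "is_graph G" and "is_graph G'"
    and "T' \<in> Ter (bags t)" and "graph_of t T' = G'"
  shows "subgraph G G' \<and> (\<forall>e\<in>edges G. endpts G e \<noteq> {}) \<longleftrightarrow>
    (\<exists>T \<in> Ter (bags t). sub_decomposition t T T' \<and> graph_of t T = G)"
proof
  assume "subgraph G G' \<and> (\<forall>e\<in>edges G. endpts G e \<noteq> {})"
  then show "\<exists>T \<in> Ter (bags t). sub_decomposition t T T' \<and> graph_of t T = G"
    using sub_decomposition_of_subgraph[of G T' t] assms by blast
next
  assume "\<exists>T \<in> Ter (bags t). sub_decomposition t T T' \<and> graph_of t T = G"
  then obtain T where T: "T \<in> Ter (bags t)" "sub_decomposition t T T'" "graph_of t T = G" by blast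
  then have "subgraph G G'"
    using subgraph_of_sub_decomposition assms(3,4) by blast
  moreover have "endpts G e \<noteq> {}" if "e \<in> edges G" for e
  proof -
    obtain p where "e = Edg p" "p \<in> Pos T" "bag_b T p \<noteq> {}"
      using \<open>e \<in> edges G\<close> T(3) edges_graph_of[of t T] by auto
    then show ?thesis using endpts_graph_of[OF T(1), of p] T(3) by simp
  qed
  ultimately show "subgraph G G' \<and> (\<forall>e\<in>edges G. endpts G e \<noteq> {})" by blast
qed

end
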